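(* Let $V\cong\mathbb{R}^d$ be a real inner product space with orthonormal basis $\{e_j\}_{j\in[d]}$, let $\|\cdot\|_{(i)}$, $i\in[k]$, be norms on $V$ satisfying $\|x\|_{(i)}\le L_i\|x\|_2$ for all $x\in V$, and fix $0\ne x_0\in V$. Set $$\kappa=\min_{i\in[k]}\frac{d\,\|x_0\|_{(i)}^2}{L_i^2\|x_0\|_2^2}-2,$$ and assume $\kappa>0$. Consider the optimally weighted max-norm $\|x\|_{\max,\mu^\ast}=\max_{i\in[k]}\|x\|_{(i)}/\|x_0\|_{(i)}$. Let $\mathcal A:V\to\mathbb{R}^m$, $\mathcal A(x)_l=\langle a_l,x\rangle$, where the $a_l$ ($l\in[m]$) are independent with $\langle a_l,e_j\rangle\sim\mathcal N(0,1)$ i.i.d. Then for every positive integer $m\le\kappa$, the probability $p_{\mathrm{success}}$ that $x_0$ is the unique minimizer of $$\min\ \|x\|_{\max,\mu^\ast}\quad\text{subject to}\quad \mathcal A(x)=\mathcal A(x_0)$$ satisfies $$p_{\mathrm{success}}\le 4\exp\Big(-\frac{(\kappa-m)^2}{8\kappa}\Big).$$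
   Context: $[k]=\{1,\dots,k\}$; $\|\cdot\|_2$ is the norm induced by the inner product of $V$. *)

theory Defs
  imports "HOL-Probability.Probability"
begin

definition is_norm_fun :: "('v::real_vector \<Rightarrow> real) \<Rightarrow> bool" where
  "is_norm_fun f \<longleftrightarrow>
     (\<forall>x. 0 \<le> f x) \<and> (\<forall>x. f x = 0 \<longleftrightarrow> x = 0) \<and>
     (\<forall>c x. f (c *\<^sub>R x) = \<bar>c\<bar> * f x) \<and> (\<forall>x y. f (x + y) \<le> f x + f y)"

definition maxnorm_opt :: "nat \<Rightarrow> (nat \<Rightarrow> 'v \<Rightarrow> real) \<Rightarrow> 'v \<Rightarrow> 'v \<Rightarrow> real" where
  "maxnorm_opt k N x0 x = Max ((\<lambda>i. N i x / N i x0) ` {1..k})"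

text \<open>Gaussian measurement ensemble: entries g(l,e) = <a_l, e> i.i.d. N(0,1),
  l in [m], e in the orthonormal basis.\<close>
definition gauss_ensemble :: "nat \<Rightarrow> (nat \<times> 'v::euclidean_space \<Rightarrow> real) measure" where
  "gauss_ensemble m = PiM ({1..m} \<times> Basis) (\<lambda>_. density lborel std_normal_density)"

definition meas_vec :: "(nat \<times> 'v::euclidean_space \<Rightarrow> real) \<Rightarrow> nat \<Rightarrow> 'v" where
  "meas_vec g l = (\<Sum>e\<in>Basis. g (l, e) *\<^sub>R e)"

definition success_event ::
  "nat \<Rightarrow> nat \<Rightarrow> (nat \<Rightarrow> 'v::euclidean_space \<Rightarrow> real) \<Rightarrow> 'v \<Rightarrow> (nat \<times> 'v \<Rightarrow> real) set" where
  "success_event m k N x0 = {g \<in> space (gauss_ensemble m).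
      \<forall>x. (\<forall>l\<in>{1..m}. meas_vec g l \<bullet> x = meas_vec g l \<bullet> x0) \<and> x \<noteq> x0
           \<longrightarrow> maxnorm_opt k N x0 x0 < maxnorm_opt k N x0 x}"

end

theory Submission
  imports Defs
begin

text \<open>
  Put \<open>q = \<kappa> / d\<close>. By the assumption on \<open>\<kappa>\<close>, all norms are at most their value at \<open>x0\<close> on the Euclidean
  ball of radius \<open>sqrt q * norm x0\<close>, so recovery can succeed only if the kernel of the measurement map
  misses the circular double cone of all \<open>v\<close> with \<open>(v \<bullet> x0)\<^sup>2 \<ge> (1 - q) (norm v)\<^sup>2 (norm x0)\<^sup>2\<close>. By rotation
  invariance the axis \<open>x0\<close> may be replaced by an independent Gaussian vector \<open>h\<close>. With the measurement
  vectors now held fixed, missing the cone forces \<open>(1 - q) (norm h)\<^sup>2\<close> to be at least the sum of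
  \<open>d - m\<close> squared coordinates of \<open>h\<close> in a suitable orthonormal basis, and the Chernoff bound for
  chi-squared variables applies.
\<close>

section \<open>Rotation invariance of Lebesgue measure\<close>

text \<open>Since the ball is symmetric, integrating \<open>1\<^sub>A(x) 1\<^sub>B(y - x)\<close> in the two possible orders
  yields \<open>lborel(A) M(B) = M(A) lborel(B)\<close>.\<close>

lemma translation_invariant_eq_lborel:
  fixes M :: "'v::euclidean_space measure"
  assumes "sigma_finite_measure M" and sets_M [measurable_cong]: "sets M = sets borel"
    and transl: "\<And>c. distr M borel ((+) c) = M"
    and ball: "emeasure M (ball 0 1) = emeasure lborel (ball (0::'v) 1)"
  shows "M = lborel"
proof (rule measure_eqI)
  fix A assume "A \<in> sets M"
  then have A [measurable]: "A \<in> sets borel" by (simp add: sets_M)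
  define B where "B = ball (0::'v) 1"
  have B [measurable]: "B \<in> sets borel" by (simp add: B_def)
  interpret M: sigma_finite_measure M by fact
  interpret pair_sigma_finite lborel M ..
  have shift_M: "(\<integral>\<^sup>+y. f (y + c) \<partial>M) = (\<integral>\<^sup>+y. f y \<partial>M)" 
    if [measurable]: "f \<in> borel_measurable borel" for f :: "'v \<Rightarrow> ennreal" and c
    by (subst (2) transl[of c, symmetric]) (simp add: nn_integral_distr add.commute)
  have shift_l: "(\<integral>\<^sup>+y. f (y + c) \<partial>lborel) = (\<integral>\<^sup>+y. f y \<partial>lborel)" 
    if [measurable]: "f \<in> borel_measurable borel" for f :: "'v \<Rightarrow> ennreal" and c
    by (subst (2) lborel_distr_plus[of c, symmetric]) (simp add: nn_integral_distr add.commute)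
  have sym: "- x \<in> B \<longleftrightarrow> x \<in> B" for x by (simp add: B_def)
  have "emeasure lborel A * emeasure M B
      = (\<integral>\<^sup>+x. indicator A x * (\<integral>\<^sup>+y. indicator B (y + - x) \<partial>M) \<partial>lborel)"
    by (subst shift_M) (simp_all add: nn_integral_multc sets_M)
  also have "\<dots> = (\<integral>\<^sup>+x. \<integral>\<^sup>+y. indicator A x * indicator B (y - x) \<partial>M \<partial>lborel)"
    by (simp add: nn_integral_cmult)
  also have "\<dots> = (\<integral>\<^sup>+y. \<integral>\<^sup>+x. indicator A x * indicator B (y - x) \<partial>lborel \<partial>M)"
    by (intro Fubini'[symmetric]) measurable
  \<comment> \<open>For fixed \<open>y\<close>, translating \<open>x\<close> by \<open>y\<close>
    moves the shift from the ball to \<open>A\<close>; symmetry of \<open>B\<close> later removes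
    the sign.\<close>
  also have "\<dots> = (\<integral>\<^sup>+y. \<integral>\<^sup>+x. indicator A (x + y) * indicator B (- x) \<partial>lborel \<partial>M)"
  proof (rule nn_integral_cong)
    fix y
    show "(\<integral>\<^sup>+x. indicator A x * indicator B (y - x) \<partial>lborel)
        = (\<integral>\<^sup>+x. indicator A (x + y) * indicator B (- x) \<partial>lborel)"
      using shift_l[of "\<lambda>x. indicator A x * indicator B (y - x)" y] by simp
  qed
  also have "\<dots> = (\<integral>\<^sup>+x. \<integral>\<^sup>+y. indicator A (y + x) * indicator B (- x) \<partial>M \<partial>lborel)"
    by (subst Fubini') (simp_all add: add.commute)
  also have "\<dots> = (\<integral>\<^sup>+x. (\<integral>\<^sup>+y. indicator A (y + x) \<partial>M) * indicator B (- x) \<partial>lborel)"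
    by (simp add: nn_integral_multc)
  also have "\<dots> = (\<integral>\<^sup>+x. emeasure M A * indicator B x \<partial>lborel)"
    by (subst shift_M) (simp_all add: sets_M indicator_def sym)
  also have "\<dots> = emeasure M A * emeasure lborel B"
    by (simp add: nn_integral_cmult)
  finally have eq: "emeasure lborel A * emeasure lborel B = emeasure M A * emeasure lborel B"
    by (simp add: B_def ball)
  \<comment> \<open>Cancelling in \<open>ennreal\<close> requires the common factor to be finite and
    nonzero.\<close>
  have "emeasure lborel B \<noteq> \<infinity>"
    using emeasure_lborel_ball_finite[of "0::'v" 1] by (auto simp: B_def)
  moreover have "emeasure lborel B \<noteq> 0"
    using open_not_negligible[of "ball (0::'v) 1"] 
    by (metis B_def centre_in_ball completion.complete emeasure_completion
        empty_iff lborelD measurable_lborel1 negligible_iff_null_sets null_sets_completionI null_setsI open_ball borel_open zero_less_one)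
  ultimately show "emeasure M A = emeasure lborel A"
    using eq by (simp add: ennreal_mult_cancel_left mult.commute[of _ "emeasure lborel B"])
qed (simp add: sets_M)

lemma borel_measurable_linear:
  fixes Q :: "'a::euclidean_space \<Rightarrow> 'b::euclidean_space"
  assumes "linear Q"
  shows "Q \<in> borel_measurable borel"
  using assms
  by (intro borel_measurable_continuous_onI linear_continuous_on) (simp add: linear_conv_bounded_linear)

text \<open>A linear isometry fixes centred balls, and since it is onto, translating the image
  measure by \<open>c = Q b\<close> amounts to translating \<open>lborel\<close> by \<open>b\<close>
  first. The characterisation by translation invariance then applies.\<close>

lemma lborel_distr_isometry:
  fixes Q :: "'v::euclidean_space \<Rightarrow> 'v"
  assumes lin: "linear Q" and nrm: "\<And>x. norm (Q x) = norm x"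
  shows "distr lborel borel Q = lborel"
proof (rule translation_invariant_eq_lborel)
  have Qm [measurable]: "Q \<in> borel_measurable borel" by (rule borel_measurable_linear) (rule lin)
  have ball: "emeasure (distr lborel borel Q) (ball 0 r) = emeasure lborel (ball (0::'v) r)" for r
  proof -
    have "Q -` ball 0 r = ball 0 r" using nrm by auto
    then show ?thesis by (simp add: emeasure_distr)
  qed
  show "emeasure (distr lborel borel Q) (ball 0 1) = emeasure lborel (ball (0::'v) 1)" by (rule ball)
  show "sigma_finite_measure (distr lborel borel Q)"
  proof (rule sigma_finite_measure.intro, intro exI conjI)
    show "countable (range (\<lambda>n::nat. ball (0::'v) (real n)))" by simp
    show "\<Union> (range (\<lambda>n::nat. ball (0::'v) (real n))) = space (distr lborel borel Q)"
      by (auto simp: reals_Archimedean2)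
    show "\<forall>a\<in>range (\<lambda>n::nat. ball (0::'v) (real n)). emeasure (distr lborel borel Q) a \<noteq> \<infinity>"
      using emeasure_lborel_ball_finite by (auto simp: ball less_top)
  qed auto
  have "inj Q"
    using lin nrm by (metis linear_injective_0 norm_eq_zero)
  then have surj: "surj Q" using lin linear_injective_imp_surjective by blast
  show "distr (distr lborel borel Q) borel ((+) c) = distr lborel borel Q" for c
  proof -
    obtain b where b: "c = Q b" using surj by (metis surjD)
    have "distr (distr lborel borel Q) borel ((+) c) = distr lborel borel (\<lambda>x. Q (b + x))"
      by (simp add: distr_distr comp_def b linear_add[OF lin])
    also have "\<dots> = distr (distr lborel borel ((+) b)) borel Q"
      by (subst distr_distr) (simp_all add: comp_def)
    finally show ?thesis by (simp only: lborel_distr_plus)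
  qed
qed simp

section \<open>Standard Gaussian vectors and the law of the measurement rows\<close>

text \<open>The law of one measurement vector, and also of the random axis. The density form reduces
  rotation invariance to that of \<open>lborel\<close>, and the product form lets integrals factor
  over coordinates.\<close>

definition gauss_vec :: "'v::euclidean_space measure" where
  "gauss_vec = density lborel (\<lambda>x. \<Prod>b\<in>Basis. ennreal (std_normal_density (x \<bullet> b)))"

lemma sets_gauss_vec [simp, measurable_cong]: "sets gauss_vec = sets borel"
  by (simp add: gauss_vec_def)

lemma space_gauss_vec [simp]: "space gauss_vec = UNIV"
  by (simp add: gauss_vec_def)

text \<open>Since the density depends on \<open>x\<close> only through \<open>norm x\<close>,
  isometries leave it unchanged.\<close>

lemma prod_std_normal_density:
  "(\<Prod>b\<in>Basis. std_normal_density (x \<bullet> b)) = (1 / sqrt (2 * pi)) ^ DIM('v) * exp (- (norm x)\<^sup>2 / 2)"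
  for x :: "'v::euclidean_space"
proof -
  have "(\<Sum>b\<in>Basis. - (x \<bullet> b)\<^sup>2 / 2) = - (norm x)\<^sup>2 / 2"
    unfolding power2_norm_eq_inner
    by (subst (2) euclidean_inner) (simp add: power2_eq_square sum_negf sum_divide_distrib)
  then show ?thesis
    unfolding std_normal_density_def prod.distrib by (simp add: exp_sum[symmetric])
qed

lemma gauss_vec_distr_isometry:
  fixes Q :: "'v::euclidean_space \<Rightarrow> 'v"
  assumes lin: "linear Q" and nrm: "\<And>x. norm (Q x) = norm x"
  shows "distr gauss_vec borel Q = gauss_vec"
proof -
  have [measurable]: "Q \<in> borel_measurable borel" by (rule borel_measurable_linear) (rule lin)
  let ?D = "\<lambda>x::'v. \<Prod>b\<in>Basis. ennreal (std_normal_density (x \<bullet> b))"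
  have D: "?D (Q x) = ?D x" for x
    by (simp add: prod_ennreal prod_std_normal_density nrm)
  have "gauss_vec = density (distr lborel borel Q) ?D"
    by (simp add: gauss_vec_def lborel_distr_isometry[OF assms])
  also have "\<dots> = distr (density lborel (\<lambda>x. ?D (Q x))) borel Q"
    by (rule density_distr) simp_all
  also have "\<dots> = distr gauss_vec borel Q" by (simp only: D gauss_vec_def)
  finally show ?thesis by simp
qed

lemma prob_space_gauss_vec: "prob_space (gauss_vec :: 'v::euclidean_space measure)"
proof
  have "emeasure gauss_vec (space gauss_vec :: 'v set)
      = (\<integral>\<^sup>+x. (\<Prod>b\<in>Basis. ennreal (std_normal_density ((x::'v) \<bullet> b))) \<partial>lborel)"
    by (simp add: gauss_vec_def emeasure_density)
  also have "\<dots> = 1"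
    by (subst nn_integral_lborel_prod) (simp_all add: nn_integral_eq_integral)
  finally show "emeasure gauss_vec (space gauss_vec :: 'v set) = 1" .
qed

text \<open>Links i.i.d. normal coordinates to the density description: the product of the
  one-dimensional laws has the product density, which is checked on boxes.\<close>

lemma gauss_vec_eq_distr_PiM:
  "distr (PiM Basis (\<lambda>_. density lborel std_normal_density)) borel (\<lambda>f. \<Sum>b\<in>Basis. f b *\<^sub>R b)
   = (gauss_vec :: 'v::euclidean_space measure)"
proof -
  let ?N = "density lborel std_normal_density"
  let ?D = "\<lambda>f. \<Prod>b\<in>(Basis::'v set). ennreal (std_normal_density (f b))"
  interpret N: prob_space ?N by (rule prob_space_normal_density) simp
  interpret PN: product_sigma_finite "\<lambda>_::'v. ?N" ..
  interpret PL: product_sigma_finite "\<lambda>_::'v. lborel :: real measure" ..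
  have "density (PiM Basis (\<lambda>_. lborel)) ?D = PiM Basis (\<lambda>_. ?N)"
  proof (rule PN.PiM_eqI)
    fix X :: "'v \<Rightarrow> real set" assume "\<And>i. i \<in> Basis \<Longrightarrow> X i \<in> sets ?N"
    then have [measurable]: "\<And>i. i \<in> Basis \<Longrightarrow> X i \<in> sets borel" by simp
    have "emeasure (density (PiM Basis (\<lambda>_. lborel)) ?D) (PiE Basis X)
        = (\<integral>\<^sup>+f. (\<Prod>b\<in>Basis. ennreal (std_normal_density (f b)) * indicator (X b) (f b)) \<partial>PiM Basis (\<lambda>_. lborel))"
    proof (subst emeasure_density)
      show "?D \<in> borel_measurable (PiM Basis (\<lambda>_. lborel))" by measurable
      show "PiE Basis X \<in> sets (PiM Basis (\<lambda>_. lborel))" by (rule sets_PiM_I_finite) auto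
      have "?D f * indicator (PiE Basis X) f
          = (\<Prod>b\<in>Basis. ennreal (std_normal_density (f b)) * indicator (X b) (f b))"
        if f: "f \<in> space (PiM Basis (\<lambda>_. lborel))" for f
      proof (cases "f \<in> PiE Basis X")
        case True
        then show ?thesis by (auto simp: PiE_iff intro!: prod.cong)
      next
        \<comment> \<open>As \<open>f\<close> is extensional on \<open>Basis\<close>, it can leave
          the box only in some coordinate of \<open>Basis\<close>, and that factor vanishes.\<close>
        case False
        then obtain b where "b \<in> Basis" "f b \<notin> X b"
          using f by (auto simp: space_PiM PiE_iff)
        then have "(\<Prod>b\<in>Basis. ennreal (std_normal_density (f b)) * indicator (X b) (f b)) = 0"
          by (intro prod_zero bexI[of _ b]) auto
        then show ?thesis using False by simp
      qed
      then show "(\<integral>\<^sup>+f. ?D f * indicator (PiE Basis X) f \<partial>PiM Basis (\<lambda>_. lborel))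
        = (\<integral>\<^sup>+f. (\<Prod>b\<in>Basis. ennreal (std_normal_density (f b)) * indicator (X b) (f b)) \<partial>PiM Basis (\<lambda>_. lborel))"
        by (rule nn_integral_cong)
    qed
    also have "\<dots> = (\<Prod>b\<in>Basis. \<integral>\<^sup>+x. ennreal (std_normal_density x) * indicator (X b) x \<partial>lborel)"
      by (rule PL.product_nn_integral_prod) auto
    also have "\<dots> = (\<Prod>b\<in>Basis. emeasure ?N (X b))"
      by (intro prod.cong refl) (simp add: emeasure_density)
    finally show "emeasure (density (PiM Basis (\<lambda>_. lborel)) ?D) (PiE Basis X) = (\<Prod>b\<in>Basis. emeasure ?N (X b))" .
  qed (auto intro!: sets_PiM_cong)
  moreover have "?D (\<lambda>b. (\<Sum>c\<in>Basis. f c *\<^sub>R c) \<bullet> b) = ?D f" for f :: "'v \<Rightarrow> real"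
    by (intro prod.cong) auto
  ultimately show ?thesis
    unfolding gauss_vec_def lborel_eq[where 'a='v]
    by (subst density_distr) auto
qed

text \<open>Each row is a function of its own block of entries; the blocks are disjoint, so the rows
  are independent Gaussian vectors. The hypothesis on \<open>m\<close> makes the index set nonempty,
  as the product characterisation of independence demands.\<close>

lemma distr_gauss_ensemble_meas_vec:
  fixes m :: nat
  assumes "m \<ge> 1"
  shows "distr (gauss_ensemble m) (PiM {1..m} (\<lambda>_. borel)) (\<lambda>g. \<lambda>l\<in>{1..m}. meas_vec g l)
     = PiM {1..m} (\<lambda>_. gauss_vec :: 'v::euclidean_space measure)"
proof -
  let ?N = "density lborel std_normal_density"
  let ?G = "gauss_ensemble m :: (nat \<times> 'v \<Rightarrow> real) measure"
  let ?K = "\<lambda>l::nat. {l} \<times> (Basis::'v set)"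
  let ?R = "\<lambda>l g. restrict (\<lambda>i. g i) (?K l)"
  let ?S = "\<lambda>l f. \<Sum>e\<in>Basis. f (l, e) *\<^sub>R (e::'v)"
  interpret N: prob_space ?N by (rule prob_space_normal_density) simp
  interpret G: prob_space ?G
    unfolding gauss_ensemble_def by (intro prob_space_PiM) (rule N.prob_space_axioms)
  have comp: "(\<lambda>g. g i) \<in> measurable ?G ?N" if "i \<in> {1..m} \<times> Basis" for i
    unfolding gauss_ensemble_def using that by (rule measurable_component_singleton)
  \<comment> \<open>Restricting to the index set is the identity on the extensional functions that
    make up the space.\<close>
  have id: "distr ?G (PiM ({1..m} \<times> Basis) (\<lambda>_. ?N)) (\<lambda>x. \<lambda>i\<in>{1..m} \<times> Basis. x i) = ?G"
  proof -
    have "distr ?G (PiM ({1..m} \<times> Basis) (\<lambda>_. ?N)) (\<lambda>x. \<lambda>i\<in>{1..m} \<times> Basis. x i) = distr ?G ?G (\<lambda>x. x)"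
      by (rule distr_cong) (auto simp: gauss_ensemble_def space_PiM PiE_restrict)
    then show ?thesis by simp
  qed
  have "G.indep_vars (\<lambda>_. ?N) (\<lambda>i g. g i) ({1..m} \<times> (Basis::'v set))"
  proof (subst G.indep_vars_iff_distr_eq_PiM')
    have "distr ?G ?N (\<lambda>g. g i) = ?N" if "i \<in> {1..m} \<times> Basis" for i
      unfolding gauss_ensemble_def using that
      by (intro distr_PiM_component) (auto simp: N.prob_space_axioms)
    then have "PiM ({1..m} \<times> Basis) (\<lambda>i. distr ?G ?N (\<lambda>g. g i)) = ?G"
      by (subst gauss_ensemble_def) (rule PiM_cong, simp_all)
    then show "distr ?G (PiM ({1..m} \<times> Basis) (\<lambda>_. ?N)) (\<lambda>x. \<lambda>i\<in>{1..m} \<times> Basis. x i)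
        = PiM ({1..m} \<times> Basis) (\<lambda>i. distr ?G ?N (\<lambda>g. g i))"
      by (simp only: id)
  qed (use assms comp in auto)
  then have "G.indep_vars (\<lambda>l. PiM (?K l) (\<lambda>_. ?N)) ?R {1..m}"
    by (rule G.indep_vars_restrict) (auto simp: disjoint_family_on_def)
  then have "G.indep_vars (\<lambda>_. borel) (\<lambda>l g. ?S l (?R l g)) {1..m}"
    by (rule G.indep_vars_compose2) auto
  moreover have S: "?S l (?R l g) = meas_vec g l" for l and g :: "nat \<times> 'v \<Rightarrow> real"
    by (simp add: meas_vec_def)
  ultimately have ind: "G.indep_vars (\<lambda>_. borel) (\<lambda>l g. meas_vec g l) {1..m}"
    by simp
  have row: "distr ?G borel (\<lambda>g. meas_vec g l) = gauss_vec" if l: "l \<in> {1..m}" for l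
  proof -
    let ?P = "PiM (Basis::'v set) (\<lambda>_. ?N)"
    have "gauss_vec = distr ?P borel (\<lambda>f. \<Sum>e\<in>Basis. f e *\<^sub>R (e::'v))"
      by (rule gauss_vec_eq_distr_PiM[symmetric])
    also have "?P = distr ?G ?P (\<lambda>g. \<lambda>e\<in>Basis. g (l, e))"
      unfolding gauss_ensemble_def using l
      by (intro distr_PiM_reindex[symmetric]) (auto simp: N.prob_space_axioms inj_on_def)
    also have "distr (distr ?G ?P (\<lambda>g. \<lambda>e\<in>Basis. g (l, e))) borel (\<lambda>f. \<Sum>e\<in>Basis. f e *\<^sub>R (e::'v))
        = distr ?G borel (\<lambda>g. meas_vec g l)"
      using l by (subst distr_distr)
        (auto simp: comp_def meas_vec_def intro!: measurable_restrict comp distr_cong)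
    finally show ?thesis ..
  qed
  have rv: "(\<lambda>g. meas_vec g l) \<in> borel_measurable ?G" if "l \<in> {1..m}" for l
    using ind that by (auto simp: G.indep_vars_def)
  have "distr ?G (PiM {1..m} (\<lambda>_. borel)) (\<lambda>g. \<lambda>l\<in>{1..m}. meas_vec g l)
      = PiM {1..m} (\<lambda>l. distr ?G borel (\<lambda>g. meas_vec g l))"
    using ind assms by (subst (asm) G.indep_vars_iff_distr_eq_PiM') (auto intro: rv)
  also have "\<dots> = PiM {1..m} (\<lambda>_. gauss_vec)"
    by (rule PiM_cong) (simp_all add: row)
  finally show ?thesis .
qed

section \<open>The cone event: measurability and rotation invariance\<close>

text \<open>A nonnegative continuous function on a compact set attains its infimum, so it has a zero
  iff it gets arbitrarily small on a countable dense subset. This replaces an uncountable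
  existential by countable operations.\<close>

lemma sets_Collect_ex_zero_compact:
  fixes F :: "'a \<Rightarrow> 'b::euclidean_space \<Rightarrow> real"
  assumes K: "compact K"
    and meas: "\<And>v. v \<in> K \<Longrightarrow> (\<lambda>w. F w v) \<in> borel_measurable M"
    and cont: "\<And>w. w \<in> space M \<Longrightarrow> continuous_on K (F w)"
    and nonneg: "\<And>w v. 0 \<le> F w v"
  shows "{w \<in> space M. \<exists>v\<in>K. F w v = 0} \<in> sets M"
proof -
  obtain D where D: "countable D" "D \<subseteq> K" "K \<subseteq> closure D"
    by (rule separable)
  have "(\<exists>v\<in>K. F w v = 0) \<longleftrightarrow> (\<forall>n::nat. \<exists>v\<in>D. F w v < 1 / Suc n)" (is "?l \<longleftrightarrow> ?r")
    if w: "w \<in> space M" for w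
  proof
    assume ?l
    then obtain v where v: "v \<in> K" "F w v = 0" by blast
    show ?r
    proof
      fix n :: nat
      obtain d where d: "d > 0" "\<And>x. x \<in> K \<Longrightarrow> dist x v < d \<Longrightarrow> dist (F w x) (F w v) < 1 / Suc n"
        using cont[OF w] v(1) unfolding continuous_on_iff
        by (metis of_nat_0_less_iff zero_less_Suc zero_less_divide_1_iff)
      obtain x where "x \<in> D" "dist x v < d"
        using D(3) v(1) d(1) by (metis closure_approachable subsetD)
      then show "\<exists>v\<in>D. F w v < 1 / Suc n"
        using d(2)[of x] D(2) v(2) nonneg[of w x] by (force simp: dist_real_def)
    qed
  next
    assume r: ?r
    then have "K \<noteq> {}" using D(2) by blast
    then obtain v where v: "v \<in> K" "\<And>y. y \<in> K \<Longrightarrow> F w v \<le> F w y"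
      using continuous_attains_inf[OF K _ cont[OF w]] by blast
    have "F w v < 1 / Suc n" for n
      using r v(2) D(2) by (meson le_less_trans subsetD)
    then have "F w v \<le> 0"
      by (metis linorder_not_le nat_approx_posE order_less_asym)
    then show ?l using v(1) nonneg[of w v] by (intro bexI[of _ v]) auto
  qed
  then have "{w \<in> space M. \<exists>v\<in>K. F w v = 0} = {w \<in> space M. \<forall>n::nat. \<exists>v\<in>D. F w v < 1 / Suc n}"
    by blast
  also have "\<dots> \<in> sets M"
  proof (intro sets.sets_Collect_countable_All sets.sets_Collect_countable_Ex' D(1))
    fix n :: nat and v assume "v \<in> D"
    then have [measurable]: "(\<lambda>w. F w v) \<in> borel_measurable M" using meas D(2) by blast
    show "{w \<in> space M. F w v < 1 / Suc n} \<in> sets M" by measurable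
  qed
  finally show ?thesis .
qed

text \<open>The cone about \<open>u\<close> has half-angle with squared cosine \<open>1 - q\<close>
  and is closed, hence the strict inequality. Testing unit vectors suffices because both kernel and
  cone are invariant under scaling.\<close>

definition misses_cone :: "nat \<Rightarrow> real \<Rightarrow> (nat \<Rightarrow> 'v::euclidean_space) \<Rightarrow> 'v \<Rightarrow> bool" where
  "misses_cone m q a u \<longleftrightarrow> (\<forall>v. norm v = 1 \<and> (\<forall>l\<in>{1..m}. a l \<bullet> v = 0)
      \<longrightarrow> (v \<bullet> u)\<^sup>2 < (1 - q) * (norm u)\<^sup>2)"

lemma pred_misses_cone [measurable]:
  "Measurable.pred (PiM {1..m} (\<lambda>_. borel) \<Otimes>\<^sub>M borel) (\<lambda>w. misses_cone m q (fst w) (snd w :: 'v::euclidean_space))"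
proof -
  let ?M = "PiM {1..m} (\<lambda>_. borel) \<Otimes>\<^sub>M (borel :: 'v measure)"
  \<comment> \<open>A penalty that vanishes exactly when \<open>v\<close> is in the kernel and in
    the cone. Measurability is joint in measurements and axis because Fubini is applied to the pair
    later.\<close>
  let ?F = "\<lambda>w v. (\<Sum>l\<in>{1..m}. \<bar>fst w l \<bullet> v\<bar>) + max 0 ((1 - q) * (norm (snd w))\<^sup>2 - (v \<bullet> snd w)\<^sup>2)"
  have zero: "?F w v = 0 \<longleftrightarrow> (\<forall>l\<in>{1..m}. fst w l \<bullet> v = 0) \<and> (1 - q) * (norm (snd w))\<^sup>2 \<le> (v \<bullet> snd w)\<^sup>2"
    for w :: "(nat \<Rightarrow> 'v) \<times> 'v" and v
    by (subst add_nonneg_eq_0_iff) (auto intro!: sum_nonneg simp: sum_nonneg_eq_0_iff max_def)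
  have "{w \<in> space ?M. \<exists>v\<in>sphere 0 1. ?F w v = 0} \<in> sets ?M"
    by (rule sets_Collect_ex_zero_compact)
       (auto intro!: continuous_intros add_nonneg_nonneg sum_nonneg)
  then have "Measurable.pred ?M (\<lambda>w. \<exists>v\<in>sphere 0 1. ?F w v = 0)" by (simp add: pred_def)
  then have "Measurable.pred ?M (\<lambda>w. \<not> (\<exists>v\<in>sphere 0 1. ?F w v = 0))" by (rule pred_intros_logic)
  moreover have "misses_cone m q (fst w) (snd w) \<longleftrightarrow> \<not> (\<exists>v\<in>sphere 0 1. ?F w v = 0)" 
    for w :: "(nat \<Rightarrow> 'v) \<times> 'v"
    unfolding zero misses_cone_def by (auto simp: not_le)
  ultimately show ?thesis by (simp only:)
qed

text \<open>Rotating the measurement vectors rotates their kernel, and every inner product in the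
  condition is preserved, by polarisation.\<close>

lemma misses_cone_isometry:
  fixes Q :: "'v::euclidean_space \<Rightarrow> 'v"
  assumes "linear Q" "\<And>x. norm (Q x) = norm x"
  shows "misses_cone m q (compose {1..m} Q a) (Q u) \<longleftrightarrow> misses_cone m q a u"
proof -
  have inner: "Q x \<bullet> Q y = x \<bullet> y" for x y
    by (simp add: dot_norm assms(2) linear_add[OF assms(1), symmetric])
  have "surj Q"
    using assms by (metis linear_injective_0 linear_injective_imp_surjective norm_eq_zero)
  \<comment> \<open>Lets the quantified kernel vector be written as \<open>Q v\<close>.\<close>
  then have surj: "(\<forall>v. P v) \<longleftrightarrow> (\<forall>v. P (Q v))" for P :: "'v \<Rightarrow> bool" by (metis surjD)
  show ?thesis
    unfolding misses_cone_def
    using surj[of "\<lambda>v. norm v = 1 \<and> (\<forall>l\<in>{1..m}. compose {1..m} Q a l \<bullet> v = 0)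
        \<longrightarrow> (v \<bullet> Q u)\<^sup>2 < (1 - q) * (norm (Q u))\<^sup>2"]
    by (simp add: compose_def inner assms(2))
qed

lemma misses_cone_scale:
  assumes "c \<noteq> 0"
  shows "misses_cone m q a (c *\<^sub>R u) \<longleftrightarrow> misses_cone m q a u"
  using assms by (simp add: misses_cone_def power_mult_distrib mult.left_commute)

text \<open>For distinct vectors the Householder reflection in the hyperplane orthogonal to
  \<open>a - b\<close> swaps them, because their norms agree.\<close>

lemma exists_isometry_maps:
  fixes a b :: "'v::euclidean_space"
  assumes "norm a = norm b"
  obtains Q :: "'v \<Rightarrow> 'v" where "linear Q" "\<And>x. norm (Q x) = norm x" "Q a = b"
proof (cases "a = b")
  case True
  then show ?thesis using that[of "\<lambda>x. x"] by (simp add: linear_id[unfolded id_def])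
next
  case False
  define v where "v = a - b"
  define Q where "Q x = x - (2 * (x \<bullet> v) / (v \<bullet> v)) *\<^sub>R v" for x
  have v: "v \<bullet> v \<noteq> 0" using False by (simp add: v_def)
  have ab: "a \<bullet> a = b \<bullet> b" using assms by (simp add: norm_eq)
  have "linear Q"
    unfolding Q_def by (intro linearI) (simp_all add: inner_add_left algebra_simps add_divide_distrib)
  moreover have "norm (Q x) = norm x" for x
    using v by (simp add: norm_eq Q_def inner_diff_left inner_diff_right inner_commute[of v x] field_simps)
  moreover have "2 * (a \<bullet> v) = v \<bullet> v"
    using ab by (simp add: v_def inner_diff_left inner_diff_right inner_commute[of b a])
  then have "Q a = b" using v by (simp add: Q_def) (simp add: v_def)
  ultimately show ?thesis using that by blast
qed

text \<open>An isometry carrying \<open>u\<close> to a positive multiple of \<open>h\<close> leaves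
  the joint law of the rows unchanged, and rescaling the axis does not affect the cone. So the
  probability is independent of the axis.\<close>

lemma emeasure_misses_cone_eq:
  fixes u h :: "'v::euclidean_space" and m :: nat
  assumes "u \<noteq> 0" "h \<noteq> 0"
  defines "G \<equiv> PiM {1..m} (\<lambda>_. gauss_vec :: 'v measure)"
  shows "emeasure G {a \<in> space G. misses_cone m q a h} = emeasure G {a \<in> space G. misses_cone m q a u}"
proof -
  have sets_G [measurable_cong]: "sets G = sets (PiM {1..m} (\<lambda>_. borel))"
    unfolding G_def by (rule sets_PiM_cong) simp_all
  have [measurable]: "Measurable.pred G (\<lambda>a. misses_cone m q a w)" for w
  proof -
    have "(\<lambda>a. (a, w)) \<in> measurable G (PiM {1..m} (\<lambda>_. borel) \<Otimes>\<^sub>M borel)" by measurable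
    from measurable_compose[OF this pred_misses_cone[of m q]] show ?thesis by simp
  qed
  obtain Q :: "'v \<Rightarrow> 'v" where Q: "linear Q" "\<And>x. norm (Q x) = norm x" "Q u = (norm u / norm h) *\<^sub>R h"
    by (rule exists_isometry_maps[of u "(norm u / norm h) *\<^sub>R h"]) (use assms in auto)
  have [measurable]: "Q \<in> borel_measurable borel" by (rule borel_measurable_linear) (rule Q(1))
  have inv: "distr G G (compose {1..m} Q) = G"
    unfolding G_def
    by (subst distr_PiM_finite_prob_space')
       (simp_all add: prob_space_gauss_vec gauss_vec_distr_isometry[OF Q(1,2)] cong: distr_cong)
  have Qm: "compose {1..m} Q \<in> measurable G G"
    unfolding compose_def G_def by measurable
  have "emeasure G {a \<in> space G. misses_cone m q a h} 
      = emeasure (distr G G (compose {1..m} Q)) {a \<in> space G. misses_cone m q a (Q u)}"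
    unfolding inv Q(3) using assms(1,2) by (simp add: misses_cone_scale)
  also have "\<dots> = emeasure G {a \<in> space G. misses_cone m q (compose {1..m} Q a) (Q u)}"
  proof (subst emeasure_distr[OF Qm])
    show "{a \<in> space G. misses_cone m q a (Q u)} \<in> sets G" by measurable
    have "compose {1..m} Q -` {a \<in> space G. misses_cone m q a (Q u)} \<inter> space G
        = {a \<in> space G. misses_cone m q (compose {1..m} Q a) (Q u)}"
      using measurable_space[OF Qm] by auto
    then show "emeasure G (compose {1..m} Q -` {a \<in> space G. misses_cone m q a (Q u)} \<inter> space G)
        = emeasure G {a \<in> space G. misses_cone m q (compose {1..m} Q a) (Q u)}"
      by (rule arg_cong)
  qed
  finally show ?thesis by (simp only: misses_cone_isometry[OF Q(1,2)])
qed

section \<open>Chernoff bound for fixed measurement vectors\<close>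

text \<open>Join orthonormal bases of the span of the measurement vectors and of its orthogonal
  complement. Indexing by \<open>Basis\<close> lets the new basis define a linear isometry.\<close>

lemma exists_adapted_orthonormal_basis:
  fixes a :: "nat \<Rightarrow> 'v::euclidean_space"
  assumes m: "m \<le> DIM('v)"
  obtains \<sigma> :: "'v \<Rightarrow> 'v" and T where "T \<subseteq> Basis" "card T = m"
    "\<And>e f. e \<in> Basis \<Longrightarrow> f \<in> Basis \<Longrightarrow> \<sigma> e \<bullet> \<sigma> f = (if e = f then 1 else 0)"
    "\<And>l e. l \<in> {1..m} \<Longrightarrow> e \<in> Basis - T \<Longrightarrow> a l \<bullet> \<sigma> e = 0"
proof -
  define E where "E = span (a ` {1..m})"
  define E' where "E' = {y \<in> UNIV. \<forall>x\<in>E. orthogonal x y}"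
  have E: "subspace E" by (simp add: E_def)
  have E': "subspace E'" by (simp add: E'_def subspace_orthogonal_to_vectors)
  have dim: "dim E' + dim E = DIM('v)"
    using dim_subspace_orthogonal_to_vectors[OF E subspace_UNIV] by (simp add: E'_def)
  have dimE: "dim E \<le> m"
    using dim_le_card'[of "a ` {1..m}"] card_image_le[of "{1..m}" a] by (simp add: E_def)
  obtain B1 where B1: "B1 \<subseteq> E" "pairwise orthogonal B1" "\<And>x. x \<in> B1 \<Longrightarrow> norm x = 1"
      "independent B1" "card B1 = dim E"
    using orthonormal_basis_subspace[OF E] by metis
  obtain B2 where B2: "B2 \<subseteq> E'" "pairwise orthogonal B2" "\<And>x. x \<in> B2 \<Longrightarrow> norm x = 1"
      "independent B2" "card B2 = dim E'"
    using orthonormal_basis_subspace[OF E'] by metis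
  have fin: "finite B1" "finite B2" using B1(4) B2(4) by (auto intro: finiteI_independent)
  have cross: "x \<bullet> y = 0" if "x \<in> B1" "y \<in> B2" for x y
    using that B1(1) B2(1) by (auto simp: E'_def orthogonal_def)
  have disj: "B1 \<inter> B2 = {}" using cross B1(3) by fastforce
  have ortho: "x \<bullet> y = 0" if "x \<in> B1 \<union> B2" "y \<in> B1 \<union> B2" "x \<noteq> y" for x y
    using that cross B1(2) B2(2) by (auto simp: pairwise_def orthogonal_def) (metis inner_commute)
  \<comment> \<open>If the measurement vectors are dependent, \<open>T\<close> is padded with kernel
    directions to size exactly \<open>m\<close>, so that the later bound does not depend on the
    rank.\<close>
  have "m - dim E \<le> card B2" using dim m B2(5) by simp
  then obtain D where D: "D \<subseteq> B2" "card D = m - dim E" by (meson obtain_subset_with_card_n)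
  have "card (B1 \<union> B2) = DIM('v)" using fin disj dim B1(5) B2(5) by (simp add: card_Un_disjoint)
  then obtain \<sigma> where \<sigma>: "bij_betw \<sigma> (Basis :: 'v set) (B1 \<union> B2)"
    using fin by (metis finite_Basis finite_UnI finite_same_card_bij)
  define T where "T = {e \<in> Basis. \<sigma> e \<in> B1 \<union> D}"
  have "\<sigma> ` T = B1 \<union> D" using \<sigma> D(1) unfolding T_def bij_betw_def by auto
  moreover have "inj_on \<sigma> T" using \<sigma> by (auto simp: T_def bij_betw_def intro: inj_on_subset)
  ultimately have "card T = card (B1 \<union> D)" by (metis card_image)
  also have "\<dots> = card B1 + card D"
    using fin D(1) disj by (intro card_Un_disjoint) (auto intro: finite_subset)
  finally have "card T = m" using D(2) B1(5) dimE by simp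
  moreover have "\<sigma> e \<bullet> \<sigma> f = (if e = f then 1 else 0)" if "e \<in> Basis" "f \<in> Basis" for e f
  proof (cases "e = f")
    case True
    have "norm (\<sigma> f) = 1" using bij_betwE[OF \<sigma>] that B1(3) B2(3) by blast
    with True show ?thesis by (simp add: norm_eq_1)
  next
    case False
    then have "\<sigma> e \<noteq> \<sigma> f" using \<sigma> that by (auto simp: bij_betw_def inj_on_def)
    with False show ?thesis using ortho bij_betwE[OF \<sigma>] that by auto
  qed
  moreover have "a l \<bullet> \<sigma> e = 0" if "l \<in> {1..m}" "e \<in> Basis - T" for l e
  proof -
    have "\<sigma> e \<in> E'" using that bij_betwE[OF \<sigma>] B2(1) by (auto simp: T_def)
    moreover have "a l \<in> E" unfolding E_def using that by (intro span_base) auto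
    ultimately show ?thesis by (auto simp: E'_def orthogonal_def)
  qed
  ultimately show ?thesis using that[of T \<sigma>] by (auto simp: T_def)
qed

text \<open>The moment generating function of a squared normal variable: the integrand is
  \<open>s\<close> times the normal density with standard deviation \<open>s\<close>.\<close>

lemma nn_integral_std_normal_exp_square:
  assumes "t < 1 / 2"
  shows "(\<integral>\<^sup>+x. ennreal (std_normal_density x * exp (t * x\<^sup>2)) \<partial>lborel) = ennreal (1 / sqrt (1 - 2 * t))"
proof -
  define s where "s = 1 / sqrt (1 - 2 * t)"
  have s: "s > 0" "1 / s\<^sup>2 = 1 - 2 * t" using assms by (simp_all add: s_def power_divide)
  have "std_normal_density x * exp (t * x\<^sup>2) = s * normal_density 0 s x" for x
  proof -
    have "- x\<^sup>2 / 2 + t * x\<^sup>2 = - (x - 0)\<^sup>2 / 2 * (1 / s\<^sup>2)" by (simp add: s(2) algebra_simps diff_divide_distrib)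
    moreover have "1 / sqrt (2 * pi) = s * (1 / sqrt (2 * pi * s\<^sup>2))"
      using s(1) by (simp add: real_sqrt_mult)
    ultimately show ?thesis
      by (simp add: std_normal_density_def normal_density_def exp_add[symmetric])
  qed
  then have "(\<integral>\<^sup>+x. ennreal (std_normal_density x * exp (t * x\<^sup>2)) \<partial>lborel)
      = (\<integral>\<^sup>+x. ennreal s * ennreal (normal_density 0 s x) \<partial>lborel)"
    using s(1) by (simp add: ennreal_mult)
  also have "\<dots> = ennreal s * (\<integral>\<^sup>+x. ennreal (normal_density 0 s x) \<partial>lborel)"
    by (rule nn_integral_cmult) simp
  also have "(\<integral>\<^sup>+x. ennreal (normal_density 0 s x) \<partial>lborel) = 1"
    using s(1) by (simp add: nn_integral_eq_integral)
  finally show ?thesis by (simp add: s_def)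
qed

lemma nn_integral_gauss_vec_exp_square:
  fixes c :: "'v::euclidean_space \<Rightarrow> real"
  assumes "\<And>e. e \<in> Basis \<Longrightarrow> c e < 1 / 2"
  shows "(\<integral>\<^sup>+x. ennreal (exp (\<Sum>e\<in>Basis. c e * (x \<bullet> e)\<^sup>2)) \<partial>gauss_vec)
      = (\<Prod>e\<in>Basis. ennreal (1 / sqrt (1 - 2 * c e)))"
proof -
  have "(\<integral>\<^sup>+x. ennreal (exp (\<Sum>e\<in>Basis. c e * (x \<bullet> e)\<^sup>2)) \<partial>gauss_vec)
      = (\<integral>\<^sup>+x. (\<Prod>e\<in>Basis. ennreal (std_normal_density (x \<bullet> e) * exp (c e * (x \<bullet> e)\<^sup>2))) \<partial>lborel)"
    unfolding gauss_vec_def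
    by (subst nn_integral_density)
       (auto intro!: nn_integral_cong simp: exp_sum prod_ennreal prod.distrib ennreal_mult[symmetric] prod_nonneg)
  also have "\<dots> = (\<Prod>e\<in>Basis. \<integral>\<^sup>+x. ennreal (std_normal_density x * exp (c e * x\<^sup>2)) \<partial>lborel)"
    by (subst nn_integral_lborel_prod) auto
  also have "\<dots> = (\<Prod>e\<in>Basis. ennreal (1 / sqrt (1 - 2 * c e)))"
    by (intro prod.cong refl nn_integral_std_normal_exp_square assms)
  finally show ?thesis .
qed

lemma pred_misses_cone_fixed [measurable]:
  "a \<in> space (PiM {1..m} (\<lambda>_. borel)) \<Longrightarrow>
     Measurable.pred borel (\<lambda>h. misses_cone m q a (h :: 'v::euclidean_space))"
  using measurable_compose[OF measurable_Pair1' pred_misses_cone[of m q]] by fastforce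

text \<open>Missing the cone forces a quadratic form in the Gaussian coordinates to be nonnegative.
  The indicator is then at most the exponential of that form, whose expectation factors over
  coordinates.\<close>

lemma emeasure_misses_cone_le:
  fixes a :: "nat \<Rightarrow> 'v::euclidean_space"
  assumes m: "m \<le> DIM('v)" and a: "a \<in> space (PiM {1..m} (\<lambda>_. borel))"
    and q: "0 \<le> q" "q \<le> 1" and s: "0 \<le> s" "2 * s * (1 - q) < 1"
  shows "emeasure gauss_vec {h. misses_cone m q a h}
    \<le> ennreal ((1 / sqrt (1 - 2 * s * (1 - q))) ^ m * (1 / sqrt (1 + 2 * s * q)) ^ (DIM('v) - m))"
proof -
  obtain \<sigma> :: "'v \<Rightarrow> 'v" and T where T: "T \<subseteq> Basis" "card T = m"
    and ortho: "\<And>e f. e \<in> Basis \<Longrightarrow> f \<in> Basis \<Longrightarrow> \<sigma> e \<bullet> \<sigma> f = (if e = f then 1 else 0)"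
    and perp: "\<And>l e. l \<in> {1..m} \<Longrightarrow> e \<in> Basis - T \<Longrightarrow> a l \<bullet> \<sigma> e = 0"
    using exists_adapted_orthonormal_basis[OF m, of a] by metis
  \<comment> \<open>Sends the standard basis to the adapted one. Replacing \<open>h\<close> by
    \<open>Q x\<close> keeps its law and turns adapted coordinates into standard ones.\<close>
  define Q where "Q x = (\<Sum>e\<in>Basis. (x \<bullet> e) *\<^sub>R \<sigma> e)" for x
  have inner: "(\<Sum>e\<in>S. (x \<bullet> e) *\<^sub>R \<sigma> e) \<bullet> Q x = (\<Sum>e\<in>S. (x \<bullet> e)\<^sup>2)" if S: "S \<subseteq> Basis" for S x
  proof -
    have "\<sigma> e \<bullet> Q x = x \<bullet> e" if "e \<in> S" for e
    proof -
      have "\<sigma> e \<bullet> Q x = (\<Sum>f\<in>Basis. (x \<bullet> f) * (if e = f then 1 else 0))"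
        unfolding Q_def inner_sum_right using that S by (intro sum.cong) (auto simp: ortho)
      also have "\<dots> = x \<bullet> e" using that S by (auto simp: if_distrib cong: if_cong)
      finally show ?thesis .
    qed
    then show ?thesis by (simp add: inner_sum_left power2_eq_square)
  qed
  have sq: "(norm x)\<^sup>2 = (\<Sum>e\<in>Basis. (x \<bullet> e)\<^sup>2)" for x :: 'v
    unfolding power2_norm_eq_inner by (subst euclidean_inner) (simp add: power2_eq_square)
  have lin: "linear Q"
    unfolding Q_def by (intro linearI) (simp_all add: inner_add_left scaleR_add_left sum.distrib scaleR_sum_right)
  have nrm: "norm (Q x) = norm x" for x
  proof (rule power2_eq_imp_eq)
    show "(norm (Q x))\<^sup>2 = (norm x)\<^sup>2"
      using inner[of Basis x] unfolding sq[of x] power2_norm_eq_inner[of "Q x"] Q_def[of x, symmetric] by simp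
  qed simp_all
  have [measurable]: "Q \<in> borel_measurable borel" by (rule borel_measurable_linear) (rule lin)
  note [measurable] = pred_misses_cone_fixed[OF a]
  \<comment> \<open>The form with these coefficients is \<open>s\<close> times the difference of
    \<open>(1 - q) * (norm x)\<^sup>2\<close> and the squared coordinates outside
    \<open>T\<close>.\<close>
  define c where "c e = (if e \<in> T then s * (1 - q) else - s * q)" for e
  have key: "0 \<le> (\<Sum>e\<in>Basis. c e * (x \<bullet> e)\<^sup>2)" if miss: "misses_cone m q a (Q x)" for x
  proof -
    \<comment> \<open>The orthogonal projection of \<open>Q x\<close> onto the span of the basis
      vectors outside \<open>T\<close>, all of which lie in the kernel; normalised, it is the test
      vector for the cone.\<close>
    define w where "w = (\<Sum>e\<in>Basis - T. (x \<bullet> e) *\<^sub>R \<sigma> e)"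
    have wQ: "w \<bullet> Q x = (\<Sum>e\<in>Basis - T. (x \<bullet> e)\<^sup>2)" 
      unfolding w_def by (rule inner) simp
    have ww: "w \<bullet> w = (\<Sum>e\<in>Basis - T. (x \<bullet> e)\<^sup>2)"
    proof -
      have "\<sigma> e \<bullet> w = x \<bullet> e" if "e \<in> Basis - T" for e
      proof -
        have "\<sigma> e \<bullet> w = (\<Sum>f\<in>Basis - T. (x \<bullet> f) * (if e = f then 1 else 0))"
          unfolding w_def inner_sum_right using that by (intro sum.cong) (auto simp: ortho)
        also have "\<dots> = x \<bullet> e" using that by (auto simp: if_distrib cong: if_cong)
        finally show ?thesis .
      qed
      then show ?thesis by (subst w_def) (simp add: inner_sum_left power2_eq_square)
    qed
    have *: "(\<Sum>e\<in>Basis - T. (x \<bullet> e)\<^sup>2) \<le> (\<Sum>e\<in>Basis. (x \<bullet> e)\<^sup>2) * (1 - q)"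
    proof (cases "w = 0")
      case True
      then have "(\<Sum>e\<in>Basis - T. (x \<bullet> e)\<^sup>2) = 0" using ww by simp
      moreover have "0 \<le> 1 - q" using q by simp
      ultimately show ?thesis by (simp add: sum_nonneg)
    next
      case False
      define v where "v = (1 / norm w) *\<^sub>R w"
      have "norm v = 1" using False by (simp add: v_def)
      moreover have "a l \<bullet> v = 0" if "l \<in> {1..m}" for l
        using perp that by (simp add: v_def w_def inner_sum_right)
      ultimately have "(v \<bullet> Q x)\<^sup>2 < (1 - q) * (norm x)\<^sup>2"
        using miss by (simp add: misses_cone_def nrm)
      moreover have "(v \<bullet> Q x)\<^sup>2 = w \<bullet> w"
        using False by (simp add: v_def wQ ww[symmetric] power_mult_distrib power_divide power2_norm_eq_inner)
          (simp add: power2_eq_square)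
      ultimately show ?thesis using ww by (simp add: sq mult.commute)
    qed
    have "(\<Sum>e\<in>Basis. c e * (x \<bullet> e)\<^sup>2)
        = s * ((1 - q) * (\<Sum>e\<in>T. (x \<bullet> e)\<^sup>2) - q * (\<Sum>e\<in>Basis - T. (x \<bullet> e)\<^sup>2))"
      using T(1) by (subst sum.subset_diff[OF T(1)]) (simp_all add: c_def sum_distrib_left sum_negf algebra_simps)
    also have "\<dots> = s * ((\<Sum>e\<in>Basis. (x \<bullet> e)\<^sup>2) * (1 - q) - (\<Sum>e\<in>Basis - T. (x \<bullet> e)\<^sup>2))"
      by (simp add: sum.subset_diff[OF T(1) finite_Basis, of "\<lambda>e. (x \<bullet> e)\<^sup>2"] algebra_simps)
    finally show ?thesis using * s(1) by simp
  qed
  have "emeasure gauss_vec {h. misses_cone m q a h} = emeasure (distr gauss_vec borel Q) {h. misses_cone m q a h}"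
    by (simp only: gauss_vec_distr_isometry[OF lin nrm])
  also have "\<dots> = emeasure gauss_vec {x. misses_cone m q a (Q x)}"
    by (subst emeasure_distr) (auto simp: vimage_def)
  also have "\<dots> = (\<integral>\<^sup>+x. indicator {x. misses_cone m q a (Q x)} x \<partial>gauss_vec)"
    by (simp add: nn_integral_indicator)
  also have "\<dots> \<le> (\<integral>\<^sup>+x. ennreal (exp (\<Sum>e\<in>Basis. c e * (x \<bullet> e)\<^sup>2)) \<partial>gauss_vec)"
    using key by (intro nn_integral_mono) (auto simp: indicator_def one_le_exp_iff)
  also have "\<dots> = (\<Prod>e\<in>Basis. ennreal (1 / sqrt (1 - 2 * c e)))"
  proof (rule nn_integral_gauss_vec_exp_square)
    fix e :: 'v
    have "0 \<le> s * q" using s q by simp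
    then show "c e < 1 / 2" using s by (simp add: c_def)
  qed
  also have "\<dots> = ennreal (\<Prod>e\<in>Basis. 1 / sqrt (1 - 2 * c e))"
  proof (rule prod_ennreal)
    fix e :: 'v
    have "0 \<le> s * q" using s q by simp
    then show "0 \<le> 1 / sqrt (1 - 2 * c e)" using s by (simp add: c_def)
  qed
  also have "(\<Prod>e\<in>Basis. 1 / sqrt (1 - 2 * c e))
      = (1 / sqrt (1 - 2 * s * (1 - q))) ^ m * (1 / sqrt (1 + 2 * s * q)) ^ (DIM('v) - m)"
    using T finite_subset[OF T(1)]
    by (subst prod.subset_diff[OF T(1)]) (simp_all add: c_def card_Diff_subset mult.assoc)
  finally show ?thesis .
qed

section \<open>The optimised exponent and the passage to a random axis\<close>

text \<open>Both factors are bounded by \<open>1 + t \<le> exp t\<close>. Taking the square root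
  before this estimate in the first factor leaves the exponent
  \<open>- m / 2 * (z - 1)\<^sup>2\<close>, which beats the target because
  \<open>z \<ge> 1\<close>.\<close>

lemma chernoff_exponent:
  fixes \<kappa> :: real and m d :: nat
  assumes m: "m \<ge> 1" "real m \<le> \<kappa>" and d: "\<kappa> < real d"
  shows "(1 / sqrt (m / \<kappa>)) ^ m * (1 / sqrt ((d - m) / (d - \<kappa>))) ^ (d - m)
    \<le> exp (- ((\<kappa> - m)\<^sup>2 / (8 * \<kappa>)))"
proof -
  define z where "z = sqrt (\<kappa> / m)"
  have z: "z \<ge> 1" and z2: "z\<^sup>2 = \<kappa> / m" using m by (simp_all add: z_def)
  have md: "real m < real d" using m d by linarith
  have half: "sqrt (exp t) = exp (t / 2)" for t :: real
    by (rule real_sqrt_unique) (simp_all add: exp_double[symmetric])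
  have "1 / sqrt (m / \<kappa>) = z" by (simp add: z_def real_sqrt_divide)
  also have "z \<le> exp (z - 1)" using exp_ge_add_one_self[of "z - 1"] by simp
  finally have "(1 / sqrt (m / \<kappa>)) ^ m \<le> exp (z - 1) ^ m"
    using m by (intro power_mono) auto
  then have 1: "(1 / sqrt (m / \<kappa>)) ^ m \<le> exp (m * (z - 1))"
    by (simp add: exp_of_nat_mult)
  have "1 / sqrt ((d - m) / (d - \<kappa>)) = sqrt ((d - \<kappa>) / (d - m))" by (simp add: real_sqrt_divide)
  also have "(d - \<kappa>) / (d - m) = 1 + - ((\<kappa> - m) / (d - m))" using md by (simp add: field_simps)
  also have "sqrt (1 + - ((\<kappa> - m) / (d - m))) \<le> sqrt (exp (- ((\<kappa> - m) / (d - m))))"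
    by (intro real_sqrt_le_mono exp_ge_add_one_self)
  also have "\<dots> = exp (- ((\<kappa> - m) / (d - m)) / 2)"
    by (rule half)
  finally have "(1 / sqrt ((d - m) / (d - \<kappa>))) ^ (d - m) \<le> exp (- ((\<kappa> - m) / (d - m)) / 2) ^ (d - m)"
    using md d by (intro power_mono) auto
  also have "\<dots> = exp (real (d - m) * (- ((\<kappa> - m) / (d - m)) / 2))"
    by (rule exp_of_nat_mult[symmetric])
  also have "real (d - m) * (- ((\<kappa> - m) / (d - m)) / 2) = - ((\<kappa> - m) / 2)"
  proof -
    have "D * (- (x / D) / 2) = - (x / 2)" if "D \<noteq> 0" for D x :: real
      using that by (simp add: field_simps)
    moreover have "real (d - m) = real d - real m" "real d - real m \<noteq> 0"
      using md by (auto simp: of_nat_diff)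
    ultimately show ?thesis by metis
  qed
  finally have 2: "(1 / sqrt ((d - m) / (d - \<kappa>))) ^ (d - m) \<le> exp (- ((\<kappa> - m) / 2))" .
  have "(1 / sqrt (m / \<kappa>)) ^ m * (1 / sqrt ((d - m) / (d - \<kappa>))) ^ (d - m)
     \<le> exp (m * (z - 1)) * exp (- ((\<kappa> - m) / 2))"
    using m d md by (intro mult_mono 1 2) auto
  also have "\<dots> = exp (m * (z - 1) - (\<kappa> - m) / 2)" by (simp add: exp_add[symmetric])
  also have "m * (z - 1) - (\<kappa> - m) / 2 \<le> - ((\<kappa> - m)\<^sup>2 / (8 * \<kappa>))"
  proof -
    have \<kappa>: "\<kappa> = m * z\<^sup>2" using z2 m by simp
    \<comment> \<open>With \<kappa> equal to \<open>m * z\<^sup>2\<close>, the difference of squares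
      \<open>z\<^sup>2 - 1\<close> factors, and the last factor is at most 1.\<close>
    have "(\<kappa> - m)\<^sup>2 / (8 * \<kappa>) = m / 2 * (z - 1)\<^sup>2 * ((z + 1)\<^sup>2 / (4 * z\<^sup>2))"
      using m z unfolding \<kappa> by (simp add: field_simps) (simp add: power2_eq_square algebra_simps)
    also have "\<dots> \<le> m / 2 * (z - 1)\<^sup>2 * 1"
    proof (intro mult_left_mono)
      have "(z + 1)\<^sup>2 \<le> (2 * z)\<^sup>2" using z by (intro power_mono) auto
      then show "(z + 1)\<^sup>2 / (4 * z\<^sup>2) \<le> 1" using z by (simp add: divide_le_eq power_mult_distrib)
    qed auto
    also have "\<dots> = - (m * (z - 1) - (\<kappa> - m) / 2)"
      unfolding \<kappa> by (simp add: power2_eq_square field_simps)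
    finally show ?thesis by simp
  qed
  finally show ?thesis by simp
qed

text \<open>The probability is the same for every nonzero axis, so it equals its average over a
  Gaussian axis. Fubini then allows the measurements to be fixed first, where the Chernoff bound is
  uniform.\<close>

lemma emeasure_misses_cone_random_le:
  fixes u :: "'v::euclidean_space"
  assumes u: "u \<noteq> 0" and m: "m \<ge> 1" "real m \<le> \<kappa>" and d: "\<kappa> < real DIM('v)"
  defines "G \<equiv> PiM {1..m} (\<lambda>_. gauss_vec :: 'v measure)"
  shows "emeasure G {a \<in> space G. misses_cone m (\<kappa> / DIM('v)) a u}
    \<le> ennreal (exp (- ((\<kappa> - m)\<^sup>2 / (8 * \<kappa>))))"
proof -
  define q where "q = \<kappa> / DIM('v)"
  \<comment> \<open>the minimizer of the Chernoff bound, i.e. \<open>1 - 2 s (1 - q) = m / \<kappa>\<close>\<close>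
  define s where "s = (\<kappa> - m) * DIM('v) / (2 * \<kappa> * (DIM('v) - \<kappa>))"
  let ?miss = "\<lambda>w. misses_cone m q (fst w) (snd w :: 'v)"
  let ?r = "exp (- ((\<kappa> - m)\<^sup>2 / (8 * \<kappa>)))"
  interpret G: prob_space G
    unfolding G_def by (intro prob_space_PiM prob_space_gauss_vec)
  interpret V: prob_space "gauss_vec :: 'v measure" by (rule prob_space_gauss_vec)
  interpret P: pair_sigma_finite G "gauss_vec :: 'v measure" ..
  have sets_G [measurable_cong]: "sets G = sets (PiM {1..m} (\<lambda>_. borel))"
    unfolding G_def by (rule sets_PiM_cong) simp_all
  have sets_P: "sets (G \<Otimes>\<^sub>M (gauss_vec :: 'v measure)) = sets (PiM {1..m} (\<lambda>_. borel) \<Otimes>\<^sub>M borel)"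
    by (intro sets_pair_measure_cong sets_G) simp
  have pred: "Measurable.pred (G \<Otimes>\<^sub>M gauss_vec) ?miss"
    using pred_misses_cone[of m q] by (simp only: measurable_cong_sets[OF sets_P refl])
  have Gm: "Measurable.pred G (\<lambda>a. misses_cone m q a w)" for w :: 'v
  proof -
    have "(\<lambda>a. (a, w)) \<in> measurable G (G \<Otimes>\<^sub>M gauss_vec)" by measurable
    from measurable_compose[OF this pred] show ?thesis by simp
  qed
  have Vm: "Measurable.pred gauss_vec (\<lambda>w::'v. misses_cone m q a w)" if "a \<in> space G" for a
  proof -
    have "(\<lambda>w. (a, w)) \<in> measurable gauss_vec (G \<Otimes>\<^sub>M (gauss_vec :: 'v measure))" 
      using that by measurable
    from measurable_compose[OF this pred] show ?thesis by simp
  qed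
  have ind: "(\<lambda>w. indicator {w. ?miss w} w :: ennreal) \<in> borel_measurable (G \<Otimes>\<^sub>M (gauss_vec :: 'v measure))"
    using pred by measurable
  \<comment> \<open>Axis independence excludes the zero vector, which is a null event for
    \<open>gauss_vec\<close>.\<close>
  have "AE h in lborel. (h::'v) \<noteq> 0" by (rule AE_lborel_singleton)
  then have ne: "AE h in gauss_vec. (h::'v) \<noteq> 0"
    unfolding gauss_vec_def by (subst AE_density) auto
  have "emeasure G {a \<in> space G. misses_cone m q a u}
      = (\<integral>\<^sup>+h. emeasure G {a \<in> space G. misses_cone m q a u} \<partial>(gauss_vec :: 'v measure))"
    by (simp add: V.emeasure_space_1[unfolded space_gauss_vec])
  also have "\<dots> = (\<integral>\<^sup>+h. emeasure G {a \<in> space G. misses_cone m q a (h::'v)} \<partial>gauss_vec)"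
  proof (rule nn_integral_cong_AE)
    show "AE h in gauss_vec. emeasure G {a \<in> space G. misses_cone m q a u}
        = emeasure G {a \<in> space G. misses_cone m q a (h::'v)}"
      using ne
    proof eventually_elim
      case (elim h)
      show ?case unfolding G_def by (rule emeasure_misses_cone_eq[OF elim u])
    qed
  qed
  also have "\<dots> = (\<integral>\<^sup>+h. \<integral>\<^sup>+a. indicator {w. ?miss w} (a, h) \<partial>G \<partial>gauss_vec)"
  proof (rule nn_integral_cong)
    fix h :: 'v
    have "(\<integral>\<^sup>+a. indicator {w. ?miss w} (a, h) \<partial>G) = (\<integral>\<^sup>+a. indicator {a \<in> space G. misses_cone m q a h} a \<partial>G)"
      by (intro nn_integral_cong) (simp add: indicator_def)
    also have "\<dots> = emeasure G {a \<in> space G. misses_cone m q a h}"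
      using Gm[of h] by (intro nn_integral_indicator) simp
    finally show "emeasure G {a \<in> space G. misses_cone m q a h} = (\<integral>\<^sup>+a. indicator {w. ?miss w} (a, h) \<partial>G)" ..
  qed
  also have "\<dots> = (\<integral>\<^sup>+a. \<integral>\<^sup>+h. indicator {w. ?miss w} (a, h) \<partial>gauss_vec \<partial>G)"
    using P.Fubini[OF ind] by simp
  also have "\<dots> \<le> (\<integral>\<^sup>+a. ennreal ?r \<partial>G)"
  proof (rule nn_integral_mono)
    fix a assume a: "a \<in> space G"
    have "(\<integral>\<^sup>+h. indicator {w. ?miss w} (a, h) \<partial>gauss_vec) 
        = (\<integral>\<^sup>+h. indicator {h. misses_cone m q a h} h \<partial>(gauss_vec :: 'v measure))"
      by (intro nn_integral_cong) (simp add: indicator_def)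
    also have "\<dots> = emeasure gauss_vec {h::'v. misses_cone m q a h}"
      using Vm[OF a] by (intro nn_integral_indicator) (simp add: pred_def)
    also have "\<dots> \<le> ennreal ((1 / sqrt (1 - 2 * s * (1 - q))) ^ m * (1 / sqrt (1 + 2 * s * q)) ^ (DIM('v) - m))"
    proof (rule emeasure_misses_cone_le)
      show "m \<le> DIM('v)" using m d by linarith
      show "a \<in> space (PiM {1..m} (\<lambda>_. borel))" using a sets_eq_imp_space_eq[OF sets_G] by simp
      show "0 \<le> q" "q \<le> 1" "0 \<le> s" using m d by (auto simp: q_def s_def)
      have "2 * s * (1 - q) = 1 - m / \<kappa>"
        using m d by (simp add: s_def q_def divide_simps)
      then show "2 * s * (1 - q) < 1" using m by simp
    qed
    also have "1 - 2 * s * (1 - q) = m / \<kappa>"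
      using m d by (simp add: s_def q_def divide_simps)
    also have "1 + 2 * s * q = real (DIM('v) - m) / (DIM('v) - \<kappa>)"
      using m d by (simp add: s_def q_def divide_simps)
    also have "ennreal ((1 / sqrt (m / \<kappa>)) ^ m * (1 / sqrt ((DIM('v) - m) / (DIM('v) - \<kappa>))) ^ (DIM('v) - m)) \<le> ennreal ?r"
      by (intro ennreal_leI chernoff_exponent m d)
    finally show "(\<integral>\<^sup>+h. indicator {w. ?miss w} (a, h) \<partial>gauss_vec) \<le> ennreal ?r" .
  qed
  also have "\<dots> = ennreal ?r" by (simp add: G.emeasure_space_1)
  finally show ?thesis by (simp only: q_def)
qed

section \<open>The success event: measurability and reduction to the cone\<close>

lemma measurable_meas_vec [measurable]:
  "l \<in> {1..m} \<Longrightarrow> (\<lambda>g. meas_vec g l) \<in> borel_measurable (gauss_ensemble m :: (nat \<times> 'v::euclidean_space \<Rightarrow> real) measure)"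
  unfolding meas_vec_def
proof (rule borel_measurable_sum)
  fix e :: 'v assume "l \<in> {1..m}" "e \<in> Basis"
  then have "(\<lambda>g. g (l, e)) \<in> measurable (gauss_ensemble m) (density lborel std_normal_density)"
    unfolding gauss_ensemble_def by (intro measurable_component_singleton) simp
  then have "(\<lambda>g. g (l, e)) \<in> borel_measurable (gauss_ensemble m)" by simp
  then show "(\<lambda>g. g (l, e) *\<^sub>R e) \<in> borel_measurable (gauss_ensemble m)" by measurable
qed

text \<open>The reverse triangle inequality gives a Lipschitz bound; the absolute value supplies a
  nonnegative constant directly.\<close>

lemma is_norm_fun_continuous:
  fixes f :: "'v::euclidean_space \<Rightarrow> real"
  assumes f: "is_norm_fun f" and L: "\<And>x. f x \<le> L * norm x"
  shows "continuous_on S f"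
proof -
  have tri: "f (x + y) \<le> f x + f y" and scale: "f (c *\<^sub>R x) = \<bar>c\<bar> * f x" for x y c
    using f by (auto simp: is_norm_fun_def)
  have lip: "f x - f y \<le> \<bar>L\<bar> * dist x y" for x y
  proof -
    have "f x - f y \<le> f (x - y)" using tri[of "x - y" y] by simp
    also have "\<dots> \<le> \<bar>L\<bar> * dist x y"
      using L[of "x - y"] mult_right_mono[OF abs_ge_self[of L] norm_ge_zero[of "x - y"]]
      by (simp add: dist_norm)
    finally show ?thesis .
  qed
  have "\<bar>L\<bar>-lipschitz_on S f"
  proof (rule lipschitz_onI)
    show "dist (f x) (f y) \<le> \<bar>L\<bar> * dist x y" for x y
      using lip[of x y] lip[of y x] by (simp add: dist_real_def abs_le_iff dist_commute)
  qed simp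
  then show ?thesis by (rule lipschitz_on_continuous_on)
qed

text \<open>The weights make every ratio equal to 1 at \<open>x0\<close>, so not exceeding the value
  there is a condition on each norm separately.\<close>

lemma maxnorm_opt_le_iff:
  assumes "k \<ge> 1" "\<And>i. i \<in> {1..k} \<Longrightarrow> N i x0 > 0"
  shows "maxnorm_opt k N x0 x \<le> maxnorm_opt k N x0 x0 \<longleftrightarrow> (\<forall>i\<in>{1..k}. N i x \<le> N i x0)"
proof -
  have "N i x0 / N i x0 = 1" if "i \<in> {1..k}" for i using assms(2)[OF that] by simp
  then have "(\<lambda>i. N i x0 / N i x0) ` {1..k} = {1}"
    using assms(1) by (auto simp: image_iff)
  then have "maxnorm_opt k N x0 x0 = 1" by (simp add: maxnorm_opt_def)
  moreover have "maxnorm_opt k N x0 x \<le> 1 \<longleftrightarrow> (\<forall>i\<in>{1..k}. N i x / N i x0 \<le> 1)"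
    unfolding maxnorm_opt_def using assms(1) by (subst Max_le_iff) auto
  ultimately show ?thesis using assms(2) by (auto simp: divide_le_eq_1_pos)
qed

text \<open>Failure means a nonzero kernel vector \<open>v\<close> for which \<open>x0 + v\<close>
  is no larger than \<open>x0\<close> in all norms. Such \<open>v\<close> are exhausted by countably
  many compact sets, each handled by the zero criterion.\<close>

lemma success_event_measurable:
  fixes N :: "nat \<Rightarrow> 'v::euclidean_space \<Rightarrow> real"
  assumes k: "k \<ge> 1" and pos: "\<And>i. i \<in> {1..k} \<Longrightarrow> N i x0 > 0"
    and cont: "\<And>i. i \<in> {1..k} \<Longrightarrow> continuous_on UNIV (N i)"
  shows "success_event m k N x0 \<in> sets (gauss_ensemble m)"
proof -
  let ?G = "gauss_ensemble m :: (nat \<times> 'v \<Rightarrow> real) measure"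
  let ?F = "\<lambda>g v. \<Sum>l\<in>{1..m}. \<bar>meas_vec g l \<bullet> v\<bar>"
  \<comment> \<open>Removing a small open ball excludes the trivial kernel vector 0 while keeping
    the set compact; the shells together cover all nonzero vectors.\<close>
  define K where "K n = {v \<in> cball 0 (Suc n) - ball 0 (1 / Suc n). \<forall>i\<in>{1..k}. N i (x0 + v) \<le> N i x0}" for n :: nat
  have zero: "?F g v = 0 \<longleftrightarrow> (\<forall>l\<in>{1..m}. meas_vec g l \<bullet> v = 0)" for g v
    by (simp add: sum_nonneg_eq_0_iff)
  have K: "compact (K n)" for n
  proof -
    have "K n = (cball 0 (Suc n) - ball 0 (1 / Suc n)) \<inter> (\<Inter>i\<in>{1..k}. {v. N i (x0 + v) \<le> N i x0})"
      by (auto simp: K_def)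
    moreover have "closed {v. N i (x0 + v) \<le> N i x0}" if "i \<in> {1..k}" for i
      by (intro closed_Collect_le continuous_intros continuous_on_compose2[OF cont[OF that]]) auto
    ultimately show ?thesis
      by (simp add: compact_Int_closed compact_diff closed_INT)
  qed
  have union: "(\<exists>n. v \<in> K n) \<longleftrightarrow> v \<noteq> 0 \<and> (\<forall>i\<in>{1..k}. N i (x0 + v) \<le> N i x0)" for v
  proof (cases "v = 0")
    case False
    obtain n1 where n1: "1 / Suc n1 < norm v" using False nat_approx_posE[of "norm v"] by auto
    obtain n2 where n2: "norm v < real n2" using reals_Archimedean2 by blast
    have "1 / real (Suc (max n1 n2)) \<le> 1 / Suc n1" by (simp add: frac_le)
    then have "v \<in> cball 0 (Suc (max n1 n2)) - ball 0 (1 / Suc (max n1 n2))"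
      using n1 n2 by auto
    then show ?thesis using False by (auto simp: K_def)
  qed (simp add: K_def)
  have fail: "\<not> (\<forall>x. (\<forall>l\<in>{1..m}. meas_vec g l \<bullet> x = meas_vec g l \<bullet> x0) \<and> x \<noteq> x0
       \<longrightarrow> maxnorm_opt k N x0 x0 < maxnorm_opt k N x0 x) \<longleftrightarrow> (\<exists>n. \<exists>v\<in>K n. ?F g v = 0)"
    (is "\<not> (\<forall>x. ?P x) \<longleftrightarrow> ?Q") for g
  proof -
    have "(\<forall>x. ?P x) \<longleftrightarrow> (\<forall>v. ?P (x0 + v))" by (metis add.commute diff_add_cancel)
    also have "\<dots> \<longleftrightarrow> (\<forall>v. \<not> (?F g v = 0 \<and> (\<exists>n. v \<in> K n)))"
    proof -
      have "maxnorm_opt k N x0 x0 < maxnorm_opt k N x0 (x0 + v) \<longleftrightarrow> \<not> (\<forall>i\<in>{1..k}. N i (x0 + v) \<le> N i x0)" for v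
        using maxnorm_opt_le_iff[of k N x0 "x0 + v"] k pos by (simp add: not_le[symmetric])
      then show ?thesis unfolding zero union by (auto simp: inner_add_right)
    qed
    also have "\<dots> \<longleftrightarrow> \<not> ?Q" by auto
    finally show ?thesis by blast
  qed
  have "success_event m k N x0 = space ?G - (\<Union>n. {g \<in> space ?G. \<exists>v\<in>K n. ?F g v = 0})"
    unfolding success_event_def using fail by auto
  also have "\<dots> \<in> sets ?G"
    by (intro sets.Diff sets.top sets.countable_UN'' sets_Collect_ex_zero_compact K)
       (auto intro!: continuous_intros sum_nonneg borel_measurable_sum
           borel_measurable_abs borel_measurable_inner measurable_meas_vec)
  finally show ?thesis .
qed

text \<open>If a kernel vector lies in the cone, the foot of the perpendicular from the origin to the
  line through \<open>x0\<close> in its direction is a feasible point that beats \<open>x0\<close> in every norm.\<close>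

lemma success_imp_misses_cone:
  fixes N :: "nat \<Rightarrow> 'v::euclidean_space \<Rightarrow> real"
  assumes k: "k \<ge> 1" and pos: "\<And>i. i \<in> {1..k} \<Longrightarrow> N i x0 > 0"
    and L: "\<And>i x. i \<in> {1..k} \<Longrightarrow> N i x \<le> L i * norm x"
    and nonneg: "\<And>i x. i \<in> {1..k} \<Longrightarrow> 0 \<le> N i x"
    and q: "q < 1" "\<And>i. i \<in> {1..k} \<Longrightarrow> q * (L i * norm x0)\<^sup>2 \<le> (N i x0)\<^sup>2"
    and x0: "x0 \<noteq> 0" and g: "g \<in> success_event m k N x0"
  shows "misses_cone m q (meas_vec g) x0"
proof (rule ccontr)
  assume "\<not> ?thesis"
  then obtain v where v: "norm v = 1" "\<And>l. l \<in> {1..m} \<Longrightarrow> meas_vec g l \<bullet> v = 0"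
      "(1 - q) * (norm x0)\<^sup>2 \<le> (v \<bullet> x0)\<^sup>2"
    unfolding misses_cone_def not_all not_imp not_less by blast
  define x where "x = x0 - (v \<bullet> x0) *\<^sub>R v"
  \<comment> \<open>A cone narrower than a half-space keeps \<open>v\<close> from being orthogonal
    to \<open>x0\<close>, so the perpendicular foot really differs from \<open>x0\<close>.\<close>
  have "0 < (1 - q) * (norm x0)\<^sup>2" using q x0 by simp
  then have "v \<bullet> x0 \<noteq> 0" using v(3) by auto
  then have "x \<noteq> x0" using v(1) by (auto simp: x_def)
  moreover have "meas_vec g l \<bullet> x = meas_vec g l \<bullet> x0" if "l \<in> {1..m}" for l
    using v(2)[OF that] by (simp add: x_def inner_diff_right)
  ultimately have "maxnorm_opt k N x0 x0 < maxnorm_opt k N x0 x"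
    using g by (simp add: success_event_def)
  then obtain i where i: "i \<in> {1..k}" "N i x0 < N i x"
    using maxnorm_opt_le_iff[of k N x0 x] k pos by (auto simp: not_le[symmetric])
  have "v \<bullet> v = 1" using v(1) by (simp add: norm_eq_1)
  then have "(norm x)\<^sup>2 = (norm x0)\<^sup>2 - (v \<bullet> x0)\<^sup>2"
    unfolding x_def power2_norm_eq_inner
    by (simp add: inner_diff_left inner_diff_right inner_commute[of x0 v] power2_eq_square)
  also have "\<dots> \<le> q * (norm x0)\<^sup>2" using v(3) by (simp add: algebra_simps)
  finally have nx: "(norm x)\<^sup>2 \<le> q * (norm x0)\<^sup>2" .
  have "(N i x)\<^sup>2 \<le> (L i * norm x)\<^sup>2"
    using L[OF i(1)] nonneg[OF i(1)] by (intro power_mono)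
  also have "\<dots> \<le> (L i)\<^sup>2 * (q * (norm x0)\<^sup>2)"
    unfolding power_mult_distrib by (intro mult_left_mono nx) simp
  also have "\<dots> = q * (L i * norm x0)\<^sup>2" by (simp add: power_mult_distrib mult.left_commute)
  also have "\<dots> \<le> (N i x0)\<^sup>2" by (rule q(2)[OF i(1)])
  finally show False using i(2) pos[OF i(1)] by (simp add: power2_le_iff_abs_le abs_if split: if_splits)
qed

section \<open>Transfer of the cone bound to the success probability\<close>

theorem theorem1:
  fixes N :: "nat \<Rightarrow> 'v::euclidean_space \<Rightarrow> real"
    and L :: "nat \<Rightarrow> real" and x0 :: 'v and k m :: nat and \<kappa> :: real
  assumes "k \<ge> 1"
    and "\<And>i. i \<in> {1..k} \<Longrightarrow> is_norm_fun (N i)"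
    and "\<And>i x. i \<in> {1..k} \<Longrightarrow> N i x \<le> L i * norm x"
    and "x0 \<noteq> 0"
    and "\<kappa> = Min ((\<lambda>i. real DIM('v) * (N i x0)\<^sup>2 / ((L i)\<^sup>2 * (norm x0)\<^sup>2)) ` {1..k}) - 2"
    and "\<kappa> > 0"
    and "m \<ge> 1" and "real m \<le> \<kappa>"
  shows "success_event m k N x0 \<in> sets (gauss_ensemble m) \<and>
         measure (gauss_ensemble m) (success_event m k N x0)
           \<le> 4 * exp (- ((\<kappa> - real m)\<^sup>2 / (8 * \<kappa>)))"
proof
  let ?M = "gauss_ensemble m :: (nat \<times> 'v \<Rightarrow> real) measure"
  let ?d = "real DIM('v)"
  \<comment> \<open>The hypotheses would allow \<open>(\<kappa> + 2) / d\<close>, but that may equal 1 and degenerate the cone to a half-space.\<close>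
  define q where "q = \<kappa> / ?d"
  define G where "G = PiM {1..m} (\<lambda>_. gauss_vec :: 'v measure)"
  define \<Phi> where "\<Phi> g = (\<lambda>l\<in>{1..m}. meas_vec g l :: 'v)" for g
  have nonneg: "0 \<le> N i x" if "i \<in> {1..k}" for i x
    using assms(2)[OF that] by (simp add: is_norm_fun_def)
  have pos: "N i x0 > 0" if "i \<in> {1..k}" for i
    using assms(2)[OF that] \<open>x0 \<noteq> 0\<close> by (metis is_norm_fun_def order_le_less)
  \<comment> \<open>The minimum in the hypothesis on \<kappa> with the denominator cleared, which is
    positive since \<open>0 < N i x0 \<le> L i * norm x0\<close>.\<close>
  have cone: "(\<kappa> + 2) * (L i * norm x0)\<^sup>2 \<le> ?d * (N i x0)\<^sup>2" if i: "i \<in> {1..k}" for i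
  proof -
    have "0 < (L i * norm x0)\<^sup>2" using pos[OF i] assms(3)[OF i, of x0] by auto
    moreover have "\<kappa> + 2 \<le> ?d * (N i x0)\<^sup>2 / (L i * norm x0)\<^sup>2"
      using i unfolding assms(5) by (simp add: power_mult_distrib)
    ultimately show ?thesis by (simp add: pos_le_divide_eq)
  qed
  \<comment> \<open>As \<open>N 1 x0 \<le> L 1 * norm x0\<close>, the first quotient under the
    minimum is at most the dimension, so the inequality holds with room 2.\<close>
  have d: "\<kappa> < ?d"
  proof -
    have i: "1 \<in> {1..k}" using assms(1) by simp
    have "(\<kappa> + 2) * (L 1 * norm x0)\<^sup>2 \<le> ?d * (N 1 x0)\<^sup>2" by (rule cone[OF i])
    also have "\<dots> \<le> ?d * (L 1 * norm x0)\<^sup>2"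
      using assms(3)[OF i, of x0] pos[OF i] by (intro mult_left_mono power_mono) auto
    finally have "\<kappa> + 2 \<le> ?d"
    proof (rule mult_right_le_imp_le)
      have "0 < L 1 * norm x0" using assms(3)[OF i, of x0] pos[OF i] by linarith
      then show "0 < (L 1 * norm x0)\<^sup>2" by (rule zero_less_power)
    qed
    then show ?thesis by simp
  qed
  show sets: "success_event m k N x0 \<in> sets ?M"
    using assms(1) pos is_norm_fun_continuous[OF assms(2,3)] by (rule success_event_measurable)
  have distr: "distr ?M (PiM {1..m} (\<lambda>_. borel)) \<Phi> = G"
    unfolding G_def \<Phi>_def by (rule distr_gauss_ensemble_meas_vec) fact
  have \<Phi> [measurable]: "\<Phi> \<in> measurable ?M (PiM {1..m} (\<lambda>_. borel))"
    unfolding \<Phi>_def by (intro measurable_restrict measurable_meas_vec)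
  define C where "C = {a \<in> space (PiM {1..m} (\<lambda>_. borel)). misses_cone m q a x0}"
  have C: "C \<in> sets (PiM {1..m} (\<lambda>_. borel))"
  proof -
    have "(\<lambda>a. (a, x0)) \<in> measurable (PiM {1..m} (\<lambda>_. borel)) (PiM {1..m} (\<lambda>_. borel) \<Otimes>\<^sub>M borel)" 
      by measurable
    from measurable_compose[OF this pred_misses_cone[of m q]] show ?thesis by (simp add: pred_def C_def)
  qed
  have sub: "success_event m k N x0 \<subseteq> \<Phi> -` C \<inter> space ?M"
  proof
    fix g assume g: "g \<in> success_event m k N x0"
    have "misses_cone m q (meas_vec g) x0"
    proof (rule success_imp_misses_cone[OF assms(1) pos assms(3) nonneg _ _ assms(4) g])
      show "q < 1" using d by (simp add: q_def divide_less_eq_1)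
      show "q * (L i * norm x0)\<^sup>2 \<le> (N i x0)\<^sup>2" if "i \<in> {1..k}" for i
      proof -
        have "\<kappa> * (L i * norm x0)\<^sup>2 \<le> (\<kappa> + 2) * (L i * norm x0)\<^sup>2" by (intro mult_right_mono) auto
        also note cone[OF that]
        finally show ?thesis by (simp add: q_def divide_le_eq mult.commute)
      qed
    qed
    \<comment> \<open>The cone condition reads only the rows in \<open>{1..m}\<close>, where
      \<open>\<Phi> g\<close> and \<open>meas_vec g\<close> agree.\<close>
    then have "misses_cone m q (\<Phi> g) x0" by (simp add: misses_cone_def \<Phi>_def)
    moreover have "g \<in> space ?M" using g by (simp add: success_event_def)
    ultimately show "g \<in> \<Phi> -` C \<inter> space ?M"
      using measurable_space[OF \<Phi>] by (simp add: C_def)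
  qed
  have "emeasure ?M (success_event m k N x0) \<le> emeasure ?M (\<Phi> -` C \<inter> space ?M)"
    by (intro emeasure_mono sub measurable_sets[OF \<Phi> C])
  also have "\<dots> = emeasure G C"
    unfolding distr[symmetric] by (rule emeasure_distr[OF \<Phi> C, symmetric])
  also have "C = {a \<in> space G. misses_cone m q a x0}"
    by (simp add: C_def G_def space_PiM)
  also have "emeasure G \<dots> \<le> ennreal (exp (- ((\<kappa> - real m)\<^sup>2 / (8 * \<kappa>))))"
    unfolding G_def q_def using assms(4,7,8) d by (rule emeasure_misses_cone_random_le)
  finally have "measure ?M (success_event m k N x0) \<le> exp (- ((\<kappa> - real m)\<^sup>2 / (8 * \<kappa>)))"
    unfolding measure_def by (simp add: enn2real_leI)
  then show "measure ?M (success_event m k N x0) \<le> 4 * exp (- ((\<kappa> - real m)\<^sup>2 / (8 * \<kappa>)))"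
    by (smt (verit) exp_gt_zero)
qed

end
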